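(* (Space Consumption for hypercoercions, $\lambda\mathsf{H}$.) If $M$ is a GTLC term with $\Gamma\vdash_G M:A$, then there exists a natural number $c$ such that for every $\lambda\mathsf{H}$ term $M':\Gamma\vdash A$ with $\mathcal C[\![M]\!]\longrightarrow_H^{*}M'$ we have $$\mathsf{real\text{-}size}(M')\le c\cdot\mathsf{ideal\text{-}size}(M').$$
   Context: **Types.** Base types $b$: $\mathtt{Nat},\mathtt{Bool},\mathtt{Int},\mathtt{Unit},\bot$. Types: $A,B,C::=b\mid\,?\mid A\to B\mid A\times B\mid A+B$; ground types $G,H::=b\mid\,?\to?\mid\,?\times?\mid\,?+?$; $\otimes$ ranges over $\{\to,\times,+\}$; $\mathsf{gnd}\,b=b$, $\mathsf{gnd}(A\otimes B)=\,?\otimes\,?$. Contexts are finite sequences of types; variables are de Bruijn indices (index $0$ is the last-added type). Primitive types $P::=b\mid b\to P$; each $b$ denotes a set (naturals, Booleans, integers, one-element set, empty set), $[\![b\to P]\!]$ is the set of functions $[\![b]\!]\to[\![P]\!]$. Blame labels $\ell$ range over a fixed set. *Consistency* $\sim$: $A\sim\,?$; $?\sim B$; $b\sim b$; $A\otimes B\sim A'\otimes B'$ if $A\sim A'$, $B\sim B'$. *Join* of consistent types: $A\sqcup\,?=A$, $?\sqcup B=B$, $b\sqcup b=b$, $(A\otimes B)\sqcup(A'\otimes B')=(A\sqcup A')\otimes(B\sqcup B')$. *Matching*: $A\triangleright A_1\otimes A_2$ iff $A=A_1\otimes A_2$, or $A=A_1=A_2=\,?$. **GTLC** typing $\Gamma\vdash_G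 M:A$: $\$k:P$ for $k\in[\![P]\!]$; $`x:A$ if $x$ has type $A$ in $\Gamma$; $\lambda[A]M:A\to B$ if $\Gamma\cdot A\vdash_G M:B$; $(L\,M)_\ell:A_2$ if $L:A$, $M:B$, $A\triangleright A_1\to A_2$, $A_1\sim B$; $\mathtt{if}_\ell\,L\,M\,N:B\sqcup C$ if $L:A$, $M:B$, $N:C$, $A\sim\mathtt{Bool}$, $B\sim C$; $\mathtt{cons}\,M\,N:A\times B$ if $M:A$, $N:B$; $\pi_i^\ell M:A_i$ if $M:A$, $A\triangleright A_1\times A_2$; $\mathtt{inl}[B]M:A+B$ if $M:A$; $\mathtt{inr}[A]M:A+B$ if $M:B$; $\mathtt{case}_\ell[B_1,C_1]\,L\,M\,N:B_2\sqcup C_2$ if $\Gamma\vdash_G L:A$, $\Gamma\cdot B_1\vdash_G M:B_2$, $\Gamma\cdot C_1\vdash_G N:C_2$, $A\sim B_1+C_1$, $B_2\sim C_2$. **Hypercoercions** $c,d:A\Rightarrow B$, with beginnings $p:A\Rightarrow_pB$, middles $m:A\Rightarrow_mB$, ends $i:A\Rightarrow_iB$: - $\mathsf{id}:\,?\Rightarrow\,?$; $(p;m;i):A\Rightarrow D$ for $p:A\Rightarrow_pB$, $m:B\Rightarrow_mC$, $i:C\Rightarrow_iD$. - $\mathsf{id}:A\Rightarrow_pA$; $H?^\ell:\,?\Rightarrow_pH$. - $\mathsf{id}:b\Rightarrow_mb$; $c\to d:(A\to B)\Rightarrow_m(C\to D)$ for $c:C\Rightarrow A$, $d:B\Rightarrow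 D$; $c\times d:(A\times B)\Rightarrow_m(C\times D)$ and $c+d:(A+B)\Rightarrow_m(C+D)$ for $c:A\Rightarrow C$, $d:B\Rightarrow D$. - $\mathsf{id}:A\Rightarrow_iA$; $G!:G\Rightarrow_i\,?$; $\bot^\ell:A\Rightarrow_iB$. *Cross*: $(\mathsf{id};c\otimes d;\mathsf{id})$, with $\mathsf{dom},\mathsf{fst},\mathsf{inl}$ returning $c$ and $\mathsf{cod},\mathsf{snd},\mathsf{inr}$ returning $d$ (for $\otimes=\to,\times,+$ respectively). *Inert*: $(\mathsf{id};m;G!)$ and $(\mathsf{id};c\to d;\mathsf{id})$. *Active*: $\mathsf{id}$; $(H?^\ell;m;i)$; $(p;m;\bot^\ell)$; $(\mathsf{id};c\times d;\mathsf{id})$; $(\mathsf{id};c+d;\mathsf{id})$; $(\mathsf{id};\mathsf{id};\mathsf{id})$. *Composition* $\ast$: $c\ast\mathsf{id}=c$; $\mathsf{id}\ast(p;m;i)=(p;m;i)$; $(p_1;m_1;\mathsf{id})\ast(\mathsf{id};m_2;i_2)=p_1;(m_1\ast m_2);i_2$; $(p_1;m_1;G!)\ast(G?^\ell;m_2;i_2)=p_1;(m_1\ast m_2);i_2$; $(p_1;m_1;G!)\ast(H?^\ell;m_2;i_2)=p_1;m_1;\bot^\ell$ if $G\neq H$; $(p_1;m_1;\bot^\ell)\ast(p_2;m_2;i_2)=p_1;m_1;\bot^\ell$. On middles: $\mathsf{id}\ast\mathsf{id}=\mathsf{id}$; $(c_1\to d_1)\ast(c_2\to d_2)=(c_2\ast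 c_1)\to(d_1\ast d_2)$; $(c_1\otimes d_1)\ast(c_2\otimes d_2)=(c_1\ast c_2)\otimes(d_1\ast d_2)$ for $\otimes\in\{\times,+\}$. *Cast constructor* for $A\sim B$: $\mathrm{coerce}(?,?,\ell)=\mathsf{id}$; for $A\ne\,?$, $\mathrm{coerce}(A,?,\ell)=\mathsf{id};\mathrm{coerce}_m(A,\mathsf{gnd}\,A,\ell);(\mathsf{gnd}\,A)!$ and $\mathrm{coerce}(?,A,\ell)=(\mathsf{gnd}\,A)?^\ell;\mathrm{coerce}_m(\mathsf{gnd}\,A,A,\ell);\mathsf{id}$; $\mathrm{coerce}(b,b,\ell)=\mathsf{id};\mathsf{id};\mathsf{id}$; $\mathrm{coerce}(A\otimes B,A'\otimes B',\ell)=\mathsf{id};\mathrm{coerce}_m(A\otimes B,A'\otimes B',\ell);\mathsf{id}$; where $\mathrm{coerce}_m(b,b,\ell)=\mathsf{id}$, $\mathrm{coerce}_m(A\to B,A'\to B',\ell)=\mathrm{coerce}(A',A,\ell)\to\mathrm{coerce}(B,B',\ell)$, and $\mathrm{coerce}_m(A\otimes B,A'\otimes B',\ell)=\mathrm{coerce}(A,A',\ell)\otimes\mathrm{coerce}(B,B',\ell)$ for $\otimes\in\{\times,+\}$. *Size*: $\mathsf{size}(\mathsf{id})=\mathsf{size}(\bot^\ell)=0$; $\mathsf{size}(G!)=\mathsf{size}(G?^\ell)=1$; $\mathsf{size}(p;m;i)=2+\mathsf{size}(p)+\mathsf{size}(m)+\mathsf{size}(i)$; $\mathsf{size}(c\otimes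 d)=1+\mathsf{size}(c)+\mathsf{size}(d)$. **Terms of $\lambda\mathsf{H}$** (intrinsically typed; $M:\Gamma\vdash A$): $\$k:P$; $`x:A$ if $x$ has type $A$ in $\Gamma$; $\lambda M:A\to B$ if $M:\Gamma\cdot A\vdash B$; $L\,M:B$ if $L:A\to B$, $M:A$; $\mathtt{if}\,L\,M\,N:B$ if $L:\mathtt{Bool}$, $M,N:B$; $\mathtt{cons}\,M\,N:A\times B$; $\pi_iM:A_i$ if $M:A_1\times A_2$; $\mathtt{inl}[B]M:A+B$ if $M:A$; $\mathtt{inr}[A]M:A+B$ if $M:B$; $\mathtt{case}\,L\,M\,N:B$ if $L:A_1+A_2$, $M:A_1\to B$, $N:A_2\to B$; $M\langle c\rangle:B$ if $M:A$, $c:A\Rightarrow B$; $\mathtt{blame}\,\ell:A$ for every $A$. *Simple values* $S$: $\lambda M$; $\$k$; $\mathtt{cons}\,V\,W$; $\mathtt{inl}[B]V$; $\mathtt{inr}[A]V$. *Values* $V,W$: $S$; $S\langle c\rangle$ with $c$ inert. *Frames* $F$: $\Box\,M$; $V\,\Box$; $\mathtt{if}\,\Box\,M\,N$; $\mathtt{cons}\,V\,\Box$; $\mathtt{cons}\,\Box\,N$; $\pi_i\Box$; $\mathtt{inl}[B]\Box$; $\mathtt{inr}[A]\Box$; $\mathtt{case}\,\Box\,M\,N$. *applyCast* on simple values (simple values never have type $?$, so active casts out of $?$ do not arise): $\mathsf{applyCast}\,S\,(\mathsf{id};m;\bot^\ell)=\mathtt{blame}\,\ell$; $\mathsf{applyCast}(\mathtt{cons}\,V_1\,V_2)(\mathsf{id};c\times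 d;\mathsf{id})=\mathtt{cons}\,(V_1\langle c\rangle)\,(V_2\langle d\rangle)$; $\mathsf{applyCast}(\mathtt{inl}\,V)(\mathsf{id};c+d;\mathsf{id})=\mathtt{inl}(V\langle c\rangle)$; $\mathsf{applyCast}(\mathtt{inr}\,V)(\mathsf{id};c+d;\mathsf{id})=\mathtt{inr}(V\langle d\rangle)$ (annotations adjusted to the target type); $\mathsf{applyCast}\,S\,(\mathsf{id};\mathsf{id};\mathsf{id})=S$. **Reduction** $ctx\vdash M\longrightarrow_HN$, $ctx\in\{\mathtt{Any},\mathtt{NonCast}\}$ ($M[V]$ substitution for variable $0$; $\uparrow$ weakening): - $\mathtt{Any}\vdash F[M]\longrightarrow F[M']$ if $ctx\vdash M\longrightarrow M'$ for some $ctx$; $\mathtt{NonCast}\vdash M\langle c\rangle\longrightarrow M'\langle c\rangle$ if $\mathtt{Any}\vdash M\longrightarrow M'$. - $\mathtt{Any}\vdash F[\mathtt{blame}\,\ell]\longrightarrow\mathtt{blame}\,\ell$; $\mathtt{NonCast}\vdash(\mathtt{blame}\,\ell)\langle c\rangle\longrightarrow\mathtt{blame}\,\ell$. - $\mathtt{NonCast}\vdash S\langle c\rangle\longrightarrow\mathsf{applyCast}\,S\,c$ for $c$ active; $\mathtt{NonCast}\vdash M\langle c\rangle\langle d\rangle\longrightarrow M\langle c\ast d\rangle$. - With $ctx=\mathtt{Any}$, for $c$ cross: $V\langle c\rangle\,W\longrightarrow(V\,(W\langle\mathsf{dom}\,c\rangle))\langle\mathsf{cod}\,c\rangle$; $\pi_1(V\langle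 c\rangle)\longrightarrow(\pi_1V)\langle\mathsf{fst}\,c\rangle$; $\pi_2(V\langle c\rangle)\longrightarrow(\pi_2V)\langle\mathsf{snd}\,c\rangle$; $\mathtt{case}\,(V\langle c\rangle)\,M\,N\longrightarrow\mathtt{case}\,V\,(\lambda((\uparrow M)\,(`0\langle\mathsf{inl}\,c\rangle)))\,(\lambda((\uparrow N)\,(`0\langle\mathsf{inr}\,c\rangle)))$. - With $ctx=\mathtt{Any}$: $(\lambda M)V\longrightarrow M[V]$; $\mathtt{if}\,\$\mathtt{true}\,M\,N\longrightarrow M$; $\mathtt{if}\,\$\mathtt{false}\,M\,N\longrightarrow N$; $\pi_1(\mathtt{cons}\,V\,W)\longrightarrow V$; $\pi_2(\mathtt{cons}\,V\,W)\longrightarrow W$; $\mathtt{case}(\mathtt{inl}[B]V)\,L\,M\longrightarrow L\,V$; $\mathtt{case}(\mathtt{inr}[A]V)\,L\,M\longrightarrow M\,V$; $\$k\,\$k'\longrightarrow\$(k(k'))$. $M\longrightarrow_H^{*}M'$ means a finite (possibly empty) sequence of such steps, each in some $ctx$. **Compilation** $\mathcal C$ (types as in the typing rules, $\langle A\Rightarrow^\ell B\rangle$ short for $\langle\mathrm{coerce}(A,B,\ell)\rangle$): $\$k\mapsto\$k$; $`x\mapsto`x$; $\lambda[A]M\mapsto\lambda\,\mathcal C[\![M]\!]$; $(L\,M)_\ell\mapsto\mathcal C[\![L]\!]\langle A\Rightarrow^\ell A_1\to A_2\rangle\;\mathcal C[\![M]\!]\langle B\Rightarrow^\ell A_1\rangle$;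 $\mathtt{if}_\ell\,L\,M\,N\mapsto\mathtt{if}\,(\mathcal C[\![L]\!]\langle A\Rightarrow^\ell\mathtt{Bool}\rangle)\,(\mathcal C[\![M]\!]\langle B\Rightarrow^\ell B\sqcup C\rangle)\,(\mathcal C[\![N]\!]\langle C\Rightarrow^\ell B\sqcup C\rangle)$; $\mathtt{cons},\mathtt{inl}[B],\mathtt{inr}[A]$ homomorphically; $\pi_i^\ell M\mapsto\pi_i(\mathcal C[\![M]\!]\langle A\Rightarrow^\ell A_1\times A_2\rangle)$; $\mathtt{case}_\ell[B_1,C_1]\,L\,M\,N\mapsto\mathtt{case}\,(\mathcal C[\![L]\!]\langle A\Rightarrow^\ell B_1+C_1\rangle)\,(\lambda\,\mathcal C[\![M]\!]\langle B_2\Rightarrow^\ell B_2\sqcup C_2\rangle)\,(\lambda\,\mathcal C[\![N]\!]\langle C_2\Rightarrow^\ell B_2\sqcup C_2\rangle)$. **Sizes of terms.** $\mathsf{ideal\text{-}size}(M\langle c\rangle)=\mathsf{ideal\text{-}size}(M)$, $\mathsf{real\text{-}size}(M\langle c\rangle)=\mathsf{size}(c)+\mathsf{real\text{-}size}(M)$; for every other term constructor both sizes are $1$ plus the sum of the corresponding sizes of the immediate subterms. *)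

theory Defs
  imports Main "HOL-Library.FuncSet"
begin

datatype base = BNat | BBool | BInt | BUnit | BVoid

datatype tyop = Arr | Times | Plus

datatype ty = Base base | Dyn (\<open>\<star>\<close>) | TOp tyop ty ty

abbreviation Fun_ty (infixr \<open>\<rightarrow>\<^sub>t\<close> 70) where "A \<rightarrow>\<^sub>t B \<equiv> TOp Arr A B"
abbreviation Prod_ty (infixr \<open>\<times>\<^sub>t\<close> 75) where "A \<times>\<^sub>t B \<equiv> TOp Times A B"
abbreviation Sum_ty (infixr \<open>+\<^sub>t\<close> 72) where "A +\<^sub>t B \<equiv> TOp Plus A B"

text \<open>A context is a list of types whose head is the last-added type, so that the de Bruijn
  index \<open>x\<close> refers to \<open>\<Gamma> ! x\<close>.\<close>

type_synonym ctxt = "ty list"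

inductive ground :: "ty \<Rightarrow> bool" where
  "ground (Base b)"
| "ground (TOp op \<star> \<star>)"

fun gnd :: "ty \<Rightarrow> ty" where
  "gnd (Base b) = Base b"
| "gnd (TOp op A B) = TOp op \<star> \<star>"

inductive consistent :: "ty \<Rightarrow> ty \<Rightarrow> bool" (infix \<open>\<sim>\<close> 50) where
  "A \<sim> \<star>"
| "\<star> \<sim> B"
| "Base b \<sim> Base b"
| "A \<sim> A' \<Longrightarrow> B \<sim> B' \<Longrightarrow> TOp op A B \<sim> TOp op A' B'"

text \<open>Meaningful for consistent arguments only.\<close>

fun join :: "ty \<Rightarrow> ty \<Rightarrow> ty" (infixl \<open>\<squnion>\<^sub>t\<close> 65) where
  "A \<squnion>\<^sub>t \<star> = A"
| "\<star> \<squnion>\<^sub>t B = B"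
| "Base b \<squnion>\<^sub>t Base b' = Base b"
| "TOp op A B \<squnion>\<^sub>t TOp op' A' B' = TOp op (A \<squnion>\<^sub>t A') (B \<squnion>\<^sub>t B')"

definition matches :: "ty \<Rightarrow> tyop \<Rightarrow> ty \<Rightarrow> ty \<Rightarrow> bool" where
  "matches A op A1 A2 \<longleftrightarrow> A = TOp op A1 A2 \<or> (A = \<star> \<and> A1 = \<star> \<and> A2 = \<star>)"

text \<open>The components \<open>A1\<close> and \<open>A2\<close> that \<open>matches A op A1 A2\<close> determines.\<close>

fun match1 :: "ty \<Rightarrow> ty" where
  "match1 (TOp op A1 A2) = A1"
| "match1 \<star> = \<star>"

fun match2 :: "ty \<Rightarrow> ty" where
  "match2 (TOp op A1 A2) = A2"
| "match2 \<star> = \<star>"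

datatype prim = PBase base | PFun base prim

fun ty_of_prim :: "prim \<Rightarrow> ty" where
  "ty_of_prim (PBase b) = Base b"
| "ty_of_prim (PFun b P) = Base b \<rightarrow>\<^sub>t ty_of_prim P"

text \<open>\<open>rep\<close> and \<open>const\<close> are universes containing the elements of all the denotations of base
  and primitive types. Functions with domain \<open>\<lbrakk>b\<rbrakk>\<close> are extensional functions on \<open>rep\<close>, so that
  each of them has exactly one representative.\<close>

datatype rep = RNat nat | RBool bool | RInt int | RUnit

fun base_den :: "base \<Rightarrow> rep set" where
  "base_den BNat = range RNat"
| "base_den BBool = range RBool"
| "base_den BInt = range RInt"
| "base_den BUnit = {RUnit}"
| "base_den BVoid = {}"

datatype const = KBase rep | KFun "rep \<Rightarrow> const"

fun prim_den :: "prim \<Rightarrow> const set" where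
  "prim_den (PBase b) = KBase ` base_den b"
| "prim_den (PFun b P) = KFun ` (base_den b \<rightarrow>\<^sub>E prim_den P)"

text \<open>Constants carry their primitive type. The blame labels are the elements of \<open>'l\<close>.\<close>

datatype 'l gterm =
    GConst prim const
  | GVar nat
  | GLam ty "'l gterm"
  | GApp "'l gterm" "'l gterm" 'l
  | GIf 'l "'l gterm" "'l gterm" "'l gterm"
  | GCons "'l gterm" "'l gterm"
  | GFst 'l "'l gterm"
  | GSnd 'l "'l gterm"
  | GInl ty "'l gterm"
  | GInr ty "'l gterm"
  | GCase 'l ty ty "'l gterm" "'l gterm" "'l gterm"

inductive gtyping :: "ctxt \<Rightarrow> 'l gterm \<Rightarrow> ty \<Rightarrow> bool"
  (\<open>(_ \<turnstile>\<^sub>G _ : _)\<close> [51, 51, 51] 50) where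
  gt_const: "k \<in> prim_den P \<Longrightarrow> \<Gamma> \<turnstile>\<^sub>G GConst P k : ty_of_prim P"
| gt_var: "x < length \<Gamma> \<Longrightarrow> \<Gamma> \<turnstile>\<^sub>G GVar x : \<Gamma> ! x"
| gt_lam: "A # \<Gamma> \<turnstile>\<^sub>G M : B \<Longrightarrow> \<Gamma> \<turnstile>\<^sub>G GLam A M : A \<rightarrow>\<^sub>t B"
| gt_app: "\<Gamma> \<turnstile>\<^sub>G L : A \<Longrightarrow> \<Gamma> \<turnstile>\<^sub>G M : B \<Longrightarrow> matches A Arr A1 A2 \<Longrightarrow> A1 \<sim> B
    \<Longrightarrow> \<Gamma> \<turnstile>\<^sub>G GApp L M l : A2"
| gt_if: "\<Gamma> \<turnstile>\<^sub>G L : A \<Longrightarrow> \<Gamma> \<turnstile>\<^sub>G M : B \<Longrightarrow> \<Gamma> \<turnstile>\<^sub>G N : C \<Longrightarrow> A \<sim> Base BBool \<Longrightarrow> B \<sim> C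
    \<Longrightarrow> \<Gamma> \<turnstile>\<^sub>G GIf l L M N : B \<squnion>\<^sub>t C"
| gt_cons: "\<Gamma> \<turnstile>\<^sub>G M : A \<Longrightarrow> \<Gamma> \<turnstile>\<^sub>G N : B \<Longrightarrow> \<Gamma> \<turnstile>\<^sub>G GCons M N : A \<times>\<^sub>t B"
| gt_fst: "\<Gamma> \<turnstile>\<^sub>G M : A \<Longrightarrow> matches A Times A1 A2 \<Longrightarrow> \<Gamma> \<turnstile>\<^sub>G GFst l M : A1"
| gt_snd: "\<Gamma> \<turnstile>\<^sub>G M : A \<Longrightarrow> matches A Times A1 A2 \<Longrightarrow> \<Gamma> \<turnstile>\<^sub>G GSnd l M : A2"
| gt_inl: "\<Gamma> \<turnstile>\<^sub>G M : A \<Longrightarrow> \<Gamma> \<turnstile>\<^sub>G GInl B M : A +\<^sub>t B"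
| gt_inr: "\<Gamma> \<turnstile>\<^sub>G M : B \<Longrightarrow> \<Gamma> \<turnstile>\<^sub>G GInr A M : A +\<^sub>t B"
| gt_case: "\<Gamma> \<turnstile>\<^sub>G L : A \<Longrightarrow> B1 # \<Gamma> \<turnstile>\<^sub>G M : B2 \<Longrightarrow> C1 # \<Gamma> \<turnstile>\<^sub>G N : C2
    \<Longrightarrow> A \<sim> B1 +\<^sub>t C1 \<Longrightarrow> B2 \<sim> C2
    \<Longrightarrow> \<Gamma> \<turnstile>\<^sub>G GCase l B1 C1 L M N : B2 \<squnion>\<^sub>t C2"

definition gtype_of :: "ctxt \<Rightarrow> 'l gterm \<Rightarrow> ty" where
  "gtype_of \<Gamma> M = (THE A. \<Gamma> \<turnstile>\<^sub>G M : A)"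

lemma matches_parts: "matches A op A1 A2 \<Longrightarrow> match1 A = A1 \<and> match2 A = A2"
  by (auto simp: matches_def)

lemma gtyping_unique: "\<Gamma> \<turnstile>\<^sub>G M : A \<Longrightarrow> \<Gamma> \<turnstile>\<^sub>G M : B \<Longrightarrow> B = A"
proof (induction arbitrary: B rule: gtyping.induct)
  case gt_const from gt_const.prems show ?case by cases auto
next
  case gt_var from gt_var.prems show ?case by cases auto
next
  case gt_lam from gt_lam.prems show ?case by cases (auto dest: gt_lam.IH)
next
  case gt_app from gt_app.prems show ?case
    by cases (metis gt_app.IH(1) gt_app.hyps(3) matches_parts)
next
  case gt_if from gt_if.prems show ?case by cases (auto dest: gt_if.IH)
next
  case gt_cons from gt_cons.prems show ?case by cases (auto dest: gt_cons.IH)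
next
  case gt_fst from gt_fst.prems show ?case
    by cases (metis gt_fst.IH gt_fst.hyps(2) matches_parts)
next
  case gt_snd from gt_snd.prems show ?case
    by cases (metis gt_snd.IH gt_snd.hyps(2) matches_parts)
next
  case gt_inl from gt_inl.prems show ?case by cases (auto dest: gt_inl.IH)
next
  case gt_inr from gt_inr.prems show ?case by cases (auto dest: gt_inr.IH)
next
  case gt_case from gt_case.prems show ?case by cases (auto dest: gt_case.IH)
qed

lemma gtype_of_eq: "\<Gamma> \<turnstile>\<^sub>G M : A \<Longrightarrow> gtype_of \<Gamma> M = A"
  unfolding gtype_of_def by (blast intro: gtyping_unique)

text \<open>The syntax records the type indices of identities and failures: \<open>PId A\<close> and \<open>EId A\<close> are the
  identities at \<open>A\<close>, \<open>MId b\<close> is the identity at \<open>b\<close>, \<open>Fail A B l\<close> is \<open>\<bottom>\<^sup>l : A \<Rightarrow> B\<close>. Moreover,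
  \<open>Prj H l\<close> is \<open>H?\<^sup>l\<close>, \<open>Inj G\<close> is \<open>G!\<close>, and \<open>CSeq p m i\<close> is \<open>p; m; i\<close>. A well-typed hypercoercion
  thus has exactly one source and one target.\<close>

datatype 'l hbegin = PId ty | Prj ty 'l

datatype 'l hend = EId ty | Inj ty | Fail ty ty 'l

datatype 'l hcoercion = CId | CSeq "'l hbegin" "'l hmiddle" "'l hend"
  and 'l hmiddle = MId base | MOp tyop "'l hcoercion" "'l hcoercion"

inductive begin_typing :: "'l hbegin \<Rightarrow> ty \<Rightarrow> ty \<Rightarrow> bool"
  (\<open>(_ : _ \<Rightarrow>\<^sub>p _)\<close> [51, 51, 51] 50) where
  "PId A : A \<Rightarrow>\<^sub>p A"
| "ground H \<Longrightarrow> Prj H l : \<star> \<Rightarrow>\<^sub>p H"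

inductive end_typing :: "'l hend \<Rightarrow> ty \<Rightarrow> ty \<Rightarrow> bool"
  (\<open>(_ : _ \<Rightarrow>\<^sub>i _)\<close> [51, 51, 51] 50) where
  "EId A : A \<Rightarrow>\<^sub>i A"
| "ground G \<Longrightarrow> Inj G : G \<Rightarrow>\<^sub>i \<star>"
| "Fail A B l : A \<Rightarrow>\<^sub>i B"

inductive hc_typing :: "'l hcoercion \<Rightarrow> ty \<Rightarrow> ty \<Rightarrow> bool"
    (\<open>(_ : _ \<Rightarrow>\<^sub>h _)\<close> [51, 51, 51] 50)
  and middle_typing :: "'l hmiddle \<Rightarrow> ty \<Rightarrow> ty \<Rightarrow> bool"
    (\<open>(_ : _ \<Rightarrow>\<^sub>m _)\<close> [51, 51, 51] 50) where
  "CId : \<star> \<Rightarrow>\<^sub>h \<star>"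
| "p : A \<Rightarrow>\<^sub>p B \<Longrightarrow> m : B \<Rightarrow>\<^sub>m C \<Longrightarrow> i : C \<Rightarrow>\<^sub>i D \<Longrightarrow> CSeq p m i : A \<Rightarrow>\<^sub>h D"
| "MId b : Base b \<Rightarrow>\<^sub>m Base b"
| "c : C \<Rightarrow>\<^sub>h A \<Longrightarrow> d : B \<Rightarrow>\<^sub>h D \<Longrightarrow> MOp Arr c d : A \<rightarrow>\<^sub>t B \<Rightarrow>\<^sub>m C \<rightarrow>\<^sub>t D"
| "c : A \<Rightarrow>\<^sub>h C \<Longrightarrow> d : B \<Rightarrow>\<^sub>h D \<Longrightarrow> MOp Times c d : A \<times>\<^sub>t B \<Rightarrow>\<^sub>m C \<times>\<^sub>t D"
| "c : A \<Rightarrow>\<^sub>h C \<Longrightarrow> d : B \<Rightarrow>\<^sub>h D \<Longrightarrow> MOp Plus c d : A +\<^sub>t B \<Rightarrow>\<^sub>m C +\<^sub>t D"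

fun begin_src :: "'l hbegin \<Rightarrow> ty" where
  "begin_src (PId A) = A"
| "begin_src (Prj H l) = \<star>"

fun end_tgt :: "'l hend \<Rightarrow> ty" where
  "end_tgt (EId A) = A"
| "end_tgt (Inj G) = \<star>"
| "end_tgt (Fail A B l) = B"

fun hc_src :: "'l hcoercion \<Rightarrow> ty" where
  "hc_src CId = \<star>"
| "hc_src (CSeq p m i) = begin_src p"

fun hc_tgt :: "'l hcoercion \<Rightarrow> ty" where
  "hc_tgt CId = \<star>"
| "hc_tgt (CSeq p m i) = end_tgt i"

text \<open>\<open>cross op c d A B\<close> is \<open>id; c op d; id\<close> with source \<open>A\<close> and target \<open>B\<close>.\<close>

abbreviation cross :: "tyop \<Rightarrow> 'l hcoercion \<Rightarrow> 'l hcoercion \<Rightarrow> ty \<Rightarrow> ty \<Rightarrow> 'l hcoercion" where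
  "cross op c d A B \<equiv> CSeq (PId A) (MOp op c d) (EId B)"

inductive inert :: "'l hcoercion \<Rightarrow> bool" where
  "inert (CSeq (PId A) m (Inj G))"
| "inert (cross Arr c d A B)"

inductive active :: "'l hcoercion \<Rightarrow> bool" where
  "active CId"
| "active (CSeq (Prj H l) m i)"
| "active (CSeq p m (Fail A B l))"
| "active (cross Times c d A B)"
| "active (cross Plus c d A B)"
| "active (CSeq (PId A) (MId b) (EId B))"

text \<open>Composition is meaningful only if the target of the first argument is the source of the
  second one, which fails for the arguments of all missing equations. Since a failure
  absorbs what follows it, its target becomes the target of the second argument.\<close>

function (sequential)
    compose :: "'l hcoercion \<Rightarrow> 'l hcoercion \<Rightarrow> 'l hcoercion" (infixl \<open>\<^bold>*\<close> 70)
  and compose_m :: "'l hmiddle \<Rightarrow> 'l hmiddle \<Rightarrow> 'l hmiddle" (infixl \<open>\<^bold>*\<^sub>m\<close> 70) where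
  "c \<^bold>* CId = c"
| "CId \<^bold>* CSeq p m i = CSeq p m i"
| "CSeq p1 m1 (EId B) \<^bold>* CSeq (PId B') m2 i2 = CSeq p1 (m1 \<^bold>*\<^sub>m m2) i2"
| "CSeq p1 m1 (Inj G) \<^bold>* CSeq (Prj H l) m2 i2 =
     (if G = H then CSeq p1 (m1 \<^bold>*\<^sub>m m2) i2 else CSeq p1 m1 (Fail G (end_tgt i2) l))"
| "CSeq p1 m1 (Fail A B l) \<^bold>* CSeq p2 m2 i2 = CSeq p1 m1 (Fail A (end_tgt i2) l)"
| "MId b \<^bold>*\<^sub>m MId b' = MId b"
| "MOp op c1 d1 \<^bold>*\<^sub>m MOp op' c2 d2 = MOp op (if op = Arr then c2 \<^bold>* c1 else c1 \<^bold>* c2) (d1 \<^bold>* d2)"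
  by pat_completeness auto
termination
  by (relation "measure (case_sum (\<lambda>(c, d). size c + size d) (\<lambda>(m, n). size m + size n))") auto

fun height :: "ty \<Rightarrow> nat" where
  "height \<star> = 0"
| "height (Base b) = 1"
| "height (TOp op A B) = Suc (max (height A) (height B))"

text \<open>\<open>coerce A B l\<close> and \<open>coerce_m A B l\<close> are meaningful for \<open>A \<sim> B\<close> only.\<close>

function (sequential)
    coerce :: "ty \<Rightarrow> ty \<Rightarrow> 'l \<Rightarrow> 'l hcoercion"
  and coerce_m :: "ty \<Rightarrow> ty \<Rightarrow> 'l \<Rightarrow> 'l hmiddle" where
  "coerce \<star> \<star> l = CId"
| "coerce A \<star> l = CSeq (PId A) (coerce_m A (gnd A) l) (Inj (gnd A))"
| "coerce \<star> A l = CSeq (Prj (gnd A) l) (coerce_m (gnd A) A l) (EId A)"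
| "coerce A B l = CSeq (PId A) (coerce_m A B l) (EId B)"
| "coerce_m (Base b) (Base b') l = MId b"
| "coerce_m (TOp op A B) (TOp op' A' B') l =
     MOp op (if op = Arr then coerce A' A l else coerce A A' l) (coerce B B' l)"
  by pat_completeness auto
termination
  by (relation "measure (case_sum
        (\<lambda>(A, B, l). 2 * max (height A) (height B) + 1)
        (\<lambda>(A, B, l). 2 * max (height A) (height B)))") auto

fun begin_size :: "'l hbegin \<Rightarrow> nat" where
  "begin_size (PId A) = 0"
| "begin_size (Prj H l) = 1"

fun end_size :: "'l hend \<Rightarrow> nat" where
  "end_size (EId A) = 0"
| "end_size (Inj G) = 1"
| "end_size (Fail A B l) = 0"

primrec hc_size :: "'l hcoercion \<Rightarrow> nat" and middle_size :: "'l hmiddle \<Rightarrow> nat" where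
  "hc_size CId = 0"
| "hc_size (CSeq p m i) = 2 + begin_size p + middle_size m + end_size i"
| "middle_size (MId b) = 0"
| "middle_size (MOp op c d) = 1 + hc_size c + hc_size d"

text \<open>Intrinsically typed terms are represented by raw terms with a typing judgement. A lambda
  records its argument type and \<open>HBlame\<close> records its type, so that in a given context a raw term
  has at most one type and at most one typing derivation.\<close>

datatype 'l hterm =
    HConst prim const
  | HVar nat
  | HLam ty "'l hterm"
  | HApp "'l hterm" "'l hterm"
  | HIf "'l hterm" "'l hterm" "'l hterm"
  | HCons "'l hterm" "'l hterm"
  | HFst "'l hterm"
  | HSnd "'l hterm"
  | HInl ty "'l hterm"
  | HInr ty "'l hterm"
  | HCase "'l hterm" "'l hterm" "'l hterm"
  | HCast "'l hterm" "'l hcoercion" (\<open>_\<langle>_\<rangle>\<close> [1000, 0] 1000)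
  | HBlame ty 'l

inductive htyping :: "ctxt \<Rightarrow> 'l hterm \<Rightarrow> ty \<Rightarrow> bool"
  (\<open>(_ \<turnstile>\<^sub>H _ : _)\<close> [51, 51, 51] 50) where
  "k \<in> prim_den P \<Longrightarrow> \<Gamma> \<turnstile>\<^sub>H HConst P k : ty_of_prim P"
| "x < length \<Gamma> \<Longrightarrow> \<Gamma> \<turnstile>\<^sub>H HVar x : \<Gamma> ! x"
| "A # \<Gamma> \<turnstile>\<^sub>H M : B \<Longrightarrow> \<Gamma> \<turnstile>\<^sub>H HLam A M : A \<rightarrow>\<^sub>t B"
| "\<Gamma> \<turnstile>\<^sub>H L : A \<rightarrow>\<^sub>t B \<Longrightarrow> \<Gamma> \<turnstile>\<^sub>H M : A \<Longrightarrow> \<Gamma> \<turnstile>\<^sub>H HApp L M : B"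
| "\<Gamma> \<turnstile>\<^sub>H L : Base BBool \<Longrightarrow> \<Gamma> \<turnstile>\<^sub>H M : B \<Longrightarrow> \<Gamma> \<turnstile>\<^sub>H N : B \<Longrightarrow> \<Gamma> \<turnstile>\<^sub>H HIf L M N : B"
| "\<Gamma> \<turnstile>\<^sub>H M : A \<Longrightarrow> \<Gamma> \<turnstile>\<^sub>H N : B \<Longrightarrow> \<Gamma> \<turnstile>\<^sub>H HCons M N : A \<times>\<^sub>t B"
| "\<Gamma> \<turnstile>\<^sub>H M : A1 \<times>\<^sub>t A2 \<Longrightarrow> \<Gamma> \<turnstile>\<^sub>H HFst M : A1"
| "\<Gamma> \<turnstile>\<^sub>H M : A1 \<times>\<^sub>t A2 \<Longrightarrow> \<Gamma> \<turnstile>\<^sub>H HSnd M : A2"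
| "\<Gamma> \<turnstile>\<^sub>H M : A \<Longrightarrow> \<Gamma> \<turnstile>\<^sub>H HInl B M : A +\<^sub>t B"
| "\<Gamma> \<turnstile>\<^sub>H M : B \<Longrightarrow> \<Gamma> \<turnstile>\<^sub>H HInr A M : A +\<^sub>t B"
| "\<Gamma> \<turnstile>\<^sub>H L : A1 +\<^sub>t A2 \<Longrightarrow> \<Gamma> \<turnstile>\<^sub>H M : A1 \<rightarrow>\<^sub>t B \<Longrightarrow> \<Gamma> \<turnstile>\<^sub>H N : A2 \<rightarrow>\<^sub>t B \<Longrightarrow> \<Gamma> \<turnstile>\<^sub>H HCase L M N : B"
| "\<Gamma> \<turnstile>\<^sub>H M : A \<Longrightarrow> c : A \<Rightarrow>\<^sub>h B \<Longrightarrow> \<Gamma> \<turnstile>\<^sub>H M\<langle>c\<rangle> : B"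
| "\<Gamma> \<turnstile>\<^sub>H HBlame A l : A"

text \<open>\<open>shift k\<close> weakens by a new variable with index \<open>k\<close>; \<open>subst k V M\<close> substitutes \<open>V\<close> for the
  variable \<open>k\<close> of \<open>M\<close> and removes that variable from the context.\<close>

primrec shift :: "nat \<Rightarrow> 'l hterm \<Rightarrow> 'l hterm" where
  "shift k (HConst P c) = HConst P c"
| "shift k (HVar x) = HVar (if x < k then x else Suc x)"
| "shift k (HLam A M) = HLam A (shift (Suc k) M)"
| "shift k (HApp L M) = HApp (shift k L) (shift k M)"
| "shift k (HIf L M N) = HIf (shift k L) (shift k M) (shift k N)"
| "shift k (HCons M N) = HCons (shift k M) (shift k N)"
| "shift k (HFst M) = HFst (shift k M)"
| "shift k (HSnd M) = HSnd (shift k M)"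
| "shift k (HInl B M) = HInl B (shift k M)"
| "shift k (HInr A M) = HInr A (shift k M)"
| "shift k (HCase L M N) = HCase (shift k L) (shift k M) (shift k N)"
| "shift k (M\<langle>c\<rangle>) = (shift k M)\<langle>c\<rangle>"
| "shift k (HBlame A l) = HBlame A l"

primrec subst :: "nat \<Rightarrow> 'l hterm \<Rightarrow> 'l hterm \<Rightarrow> 'l hterm" where
  "subst k V (HConst P c) = HConst P c"
| "subst k V (HVar x) = (if x < k then HVar x else if x = k then V else HVar (x - 1))"
| "subst k V (HLam A M) = HLam A (subst (Suc k) (shift 0 V) M)"
| "subst k V (HApp L M) = HApp (subst k V L) (subst k V M)"
| "subst k V (HIf L M N) = HIf (subst k V L) (subst k V M) (subst k V N)"
| "subst k V (HCons M N) = HCons (subst k V M) (subst k V N)"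
| "subst k V (HFst M) = HFst (subst k V M)"
| "subst k V (HSnd M) = HSnd (subst k V M)"
| "subst k V (HInl B M) = HInl B (subst k V M)"
| "subst k V (HInr A M) = HInr A (subst k V M)"
| "subst k V (HCase L M N) = HCase (subst k V L) (subst k V M) (subst k V N)"
| "subst k V (M\<langle>c\<rangle>) = (subst k V M)\<langle>c\<rangle>"
| "subst k V (HBlame A l) = HBlame A l"

inductive simple :: "'l hterm \<Rightarrow> bool" and val :: "'l hterm \<Rightarrow> bool" where
  "simple (HLam A M)"
| "simple (HConst P k)"
| "val V \<Longrightarrow> val W \<Longrightarrow> simple (HCons V W)"
| "val V \<Longrightarrow> simple (HInl B V)"
| "val V \<Longrightarrow> simple (HInr A V)"
| "simple S \<Longrightarrow> val S"
| "simple S \<Longrightarrow> inert c \<Longrightarrow> val (S\<langle>c\<rangle>)"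

text \<open>Frames are represented by the functions that fill their hole.\<close>

inductive frame :: "('l hterm \<Rightarrow> 'l hterm) \<Rightarrow> bool" where
  "frame (\<lambda>X. HApp X M)"
| "val V \<Longrightarrow> frame (\<lambda>X. HApp V X)"
| "frame (\<lambda>X. HIf X M N)"
| "val V \<Longrightarrow> frame (\<lambda>X. HCons V X)"
| "frame (\<lambda>X. HCons X N)"
| "frame (\<lambda>X. HFst X)"
| "frame (\<lambda>X. HSnd X)"
| "frame (\<lambda>X. HInl B X)"
| "frame (\<lambda>X. HInr A X)"
| "frame (\<lambda>X. HCase X M N)"

text \<open>Applied to simple values and active hypercoercions only. The missing equations cannot be
  reached from well-typed terms, as simple values never have type \<open>\<star>\<close>.\<close>

fun apply_cast :: "'l hterm \<Rightarrow> 'l hcoercion \<Rightarrow> 'l hterm" where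
  "apply_cast S (CSeq (PId A) m (Fail B C l)) = HBlame C l"
| "apply_cast (HCons V1 V2) (CSeq (PId A) (MOp Times c d) (EId B)) = HCons (V1\<langle>c\<rangle>) (V2\<langle>d\<rangle>)"
| "apply_cast (HInl B' V) (CSeq (PId A) (MOp Plus c d) (EId B)) = HInl (hc_tgt d) (V\<langle>c\<rangle>)"
| "apply_cast (HInr A' V) (CSeq (PId A) (MOp Plus c d) (EId B)) = HInr (hc_tgt c) (V\<langle>d\<rangle>)"
| "apply_cast S (CSeq (PId A) (MId b) (EId B)) = S"

datatype rctx = Any | NonCast

text \<open>Reduction of terms over a fixed context \<open>\<Gamma>\<close>. The context is used only in \<open>red_frame_blame\<close>,
  to annotate the resulting \<open>HBlame\<close> with the type of the term it replaces.\<close>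

inductive red :: "ctxt \<Rightarrow> rctx \<Rightarrow> 'l hterm \<Rightarrow> 'l hterm \<Rightarrow> bool" for \<Gamma> :: ctxt where
  red_frame: "frame F \<Longrightarrow> red \<Gamma> ctx M M' \<Longrightarrow> red \<Gamma> Any (F M) (F M')"
| red_cast: "red \<Gamma> Any M M' \<Longrightarrow> red \<Gamma> NonCast (M\<langle>c\<rangle>) (M'\<langle>c\<rangle>)"
| red_frame_blame: "frame F \<Longrightarrow> \<Gamma> \<turnstile>\<^sub>H F (HBlame A l) : B \<Longrightarrow> red \<Gamma> Any (F (HBlame A l)) (HBlame B l)"
| red_cast_blame: "red \<Gamma> NonCast ((HBlame A l)\<langle>c\<rangle>) (HBlame (hc_tgt c) l)"
| red_apply_cast: "simple S \<Longrightarrow> active c \<Longrightarrow> red \<Gamma> NonCast (S\<langle>c\<rangle>) (apply_cast S c)"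
| red_compose: "red \<Gamma> NonCast (M\<langle>c\<rangle>\<langle>d\<rangle>) (M\<langle>c \<^bold>* d\<rangle>)"
| red_fun_cast: "val V \<Longrightarrow> val W
    \<Longrightarrow> red \<Gamma> Any (HApp (V\<langle>cross Arr c d A B\<rangle>) W) ((HApp V (W\<langle>c\<rangle>))\<langle>d\<rangle>)"
| red_fst_cast: "val V \<Longrightarrow> red \<Gamma> Any (HFst (V\<langle>cross Times c d A B\<rangle>)) ((HFst V)\<langle>c\<rangle>)"
| red_snd_cast: "val V \<Longrightarrow> red \<Gamma> Any (HSnd (V\<langle>cross Times c d A B\<rangle>)) ((HSnd V)\<langle>d\<rangle>)"
| red_case_cast: "val V \<Longrightarrow> red \<Gamma> Any (HCase (V\<langle>cross Plus c d A B\<rangle>) M N)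
      (HCase V (HLam (hc_src c) (HApp (shift 0 M) ((HVar 0)\<langle>c\<rangle>)))
              (HLam (hc_src d) (HApp (shift 0 N) ((HVar 0)\<langle>d\<rangle>))))"
| red_beta: "val V \<Longrightarrow> red \<Gamma> Any (HApp (HLam A M) V) (subst 0 V M)"
| red_if_true: "red \<Gamma> Any (HIf (HConst (PBase BBool) (KBase (RBool True))) M N) M"
| red_if_false: "red \<Gamma> Any (HIf (HConst (PBase BBool) (KBase (RBool False))) M N) N"
| red_fst: "val V \<Longrightarrow> val W \<Longrightarrow> red \<Gamma> Any (HFst (HCons V W)) V"
| red_snd: "val V \<Longrightarrow> val W \<Longrightarrow> red \<Gamma> Any (HSnd (HCons V W)) W"
| red_case_inl: "val V \<Longrightarrow> red \<Gamma> Any (HCase (HInl B V) L M) (HApp L V)"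
| red_case_inr: "val V \<Longrightarrow> red \<Gamma> Any (HCase (HInr A V) L M) (HApp M V)"
| red_delta: "red \<Gamma> Any (HApp (HConst (PFun b P) (KFun f)) (HConst (PBase b) (KBase r))) (HConst P (f r))"

definition step :: "ctxt \<Rightarrow> 'l hterm \<Rightarrow> 'l hterm \<Rightarrow> bool"
  (\<open>(_ \<turnstile> _ \<longrightarrow>\<^sub>H _)\<close> [51, 51, 51] 50) where
  "\<Gamma> \<turnstile> M \<longrightarrow>\<^sub>H N \<longleftrightarrow> (\<exists>ctx. red \<Gamma> ctx M N)"

abbreviation steps :: "ctxt \<Rightarrow> 'l hterm \<Rightarrow> 'l hterm \<Rightarrow> bool"
  (\<open>(_ \<turnstile> _ \<longrightarrow>\<^sub>H\<^sup>* _)\<close> [51, 51, 51] 50) where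
  "\<Gamma> \<turnstile> M \<longrightarrow>\<^sub>H\<^sup>* N \<equiv> (step \<Gamma>)\<^sup>*\<^sup>* M N"

primrec compile :: "ctxt \<Rightarrow> 'l gterm \<Rightarrow> 'l hterm" where
  "compile \<Gamma> (GConst P k) = HConst P k"
| "compile \<Gamma> (GVar x) = HVar x"
| "compile \<Gamma> (GLam A M) = HLam A (compile (A # \<Gamma>) M)"
| "compile \<Gamma> (GApp L M l) =
    (let A = gtype_of \<Gamma> L; B = gtype_of \<Gamma> M; A1 = match1 A; A2 = match2 A
     in HApp ((compile \<Gamma> L)\<langle>coerce A (A1 \<rightarrow>\<^sub>t A2) l\<rangle>) ((compile \<Gamma> M)\<langle>coerce B A1 l\<rangle>))"
| "compile \<Gamma> (GIf l L M N) =
    (let A = gtype_of \<Gamma> L; B = gtype_of \<Gamma> M; C = gtype_of \<Gamma> N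
     in HIf ((compile \<Gamma> L)\<langle>coerce A (Base BBool) l\<rangle>)
           ((compile \<Gamma> M)\<langle>coerce B (B \<squnion>\<^sub>t C) l\<rangle>)
           ((compile \<Gamma> N)\<langle>coerce C (B \<squnion>\<^sub>t C) l\<rangle>))"
| "compile \<Gamma> (GCons M N) = HCons (compile \<Gamma> M) (compile \<Gamma> N)"
| "compile \<Gamma> (GFst l M) =
    (let A = gtype_of \<Gamma> M; A1 = match1 A; A2 = match2 A
     in HFst ((compile \<Gamma> M)\<langle>coerce A (A1 \<times>\<^sub>t A2) l\<rangle>))"
| "compile \<Gamma> (GSnd l M) =
    (let A = gtype_of \<Gamma> M; A1 = match1 A; A2 = match2 A
     in HSnd ((compile \<Gamma> M)\<langle>coerce A (A1 \<times>\<^sub>t A2) l\<rangle>))"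
| "compile \<Gamma> (GInl B M) = HInl B (compile \<Gamma> M)"
| "compile \<Gamma> (GInr A M) = HInr A (compile \<Gamma> M)"
| "compile \<Gamma> (GCase l B1 C1 L M N) =
    (let A = gtype_of \<Gamma> L; B2 = gtype_of (B1 # \<Gamma>) M; C2 = gtype_of (C1 # \<Gamma>) N
     in HCase ((compile \<Gamma> L)\<langle>coerce A (B1 +\<^sub>t C1) l\<rangle>)
             (HLam B1 ((compile (B1 # \<Gamma>) M)\<langle>coerce B2 (B2 \<squnion>\<^sub>t C2) l\<rangle>))
             (HLam C1 ((compile (C1 # \<Gamma>) N)\<langle>coerce C2 (B2 \<squnion>\<^sub>t C2) l\<rangle>)))"

primrec ideal_size :: "'l hterm \<Rightarrow> nat" where
  "ideal_size (HConst P k) = 1"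
| "ideal_size (HVar x) = 1"
| "ideal_size (HLam A M) = 1 + ideal_size M"
| "ideal_size (HApp L M) = 1 + ideal_size L + ideal_size M"
| "ideal_size (HIf L M N) = 1 + ideal_size L + ideal_size M + ideal_size N"
| "ideal_size (HCons M N) = 1 + ideal_size M + ideal_size N"
| "ideal_size (HFst M) = 1 + ideal_size M"
| "ideal_size (HSnd M) = 1 + ideal_size M"
| "ideal_size (HInl B M) = 1 + ideal_size M"
| "ideal_size (HInr A M) = 1 + ideal_size M"
| "ideal_size (HCase L M N) = 1 + ideal_size L + ideal_size M + ideal_size N"
| "ideal_size (M\<langle>c\<rangle>) = ideal_size M"
| "ideal_size (HBlame A l) = 1"

primrec real_size :: "'l hterm \<Rightarrow> nat" where
  "real_size (HConst P k) = 1"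
| "real_size (HVar x) = 1"
| "real_size (HLam A M) = 1 + real_size M"
| "real_size (HApp L M) = 1 + real_size L + real_size M"
| "real_size (HIf L M N) = 1 + real_size L + real_size M + real_size N"
| "real_size (HCons M N) = 1 + real_size M + real_size N"
| "real_size (HFst M) = 1 + real_size M"
| "real_size (HSnd M) = 1 + real_size M"
| "real_size (HInl B M) = 1 + real_size M"
| "real_size (HInr A M) = 1 + real_size M"
| "real_size (HCase L M N) = 1 + real_size L + real_size M + real_size N"
| "real_size (M\<langle>c\<rangle>) = hc_size c + real_size M"
| "real_size (HBlame A l) = 1"

end

theory Submission
  imports Defs
begin

text \<open>Composition does not increase the height of hypercoercions and the size of a hypercoercion is
  at most exponential in its height, so every cast in a reduct of \<open>M\<close> has a size bounded in
  terms of the compilation of \<open>M\<close> alone. It remains to bound the number of adjacent casts.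
  Reduction below a cast never uses the rules for casts, so that nested casts must be composed from
  the outside until a single one is left before their body reduces, and a reduct of the body
  contributes at most two more. Hence at most three casts are adjacent at any time.\<close>

section \<open>Typing of hypercoercions\<close>

inductive_cases begin_typingE [elim!]:
  "PId A : B \<Rightarrow>\<^sub>p C" "Prj H l : B \<Rightarrow>\<^sub>p C"

inductive_cases end_typingE [elim!]:
  "EId A : B \<Rightarrow>\<^sub>i C" "Inj G : B \<Rightarrow>\<^sub>i C" "Fail A B l : C \<Rightarrow>\<^sub>i D"

inductive_cases hc_typingE [elim!]:
  "CId : A \<Rightarrow>\<^sub>h B" "CSeq p m i : A \<Rightarrow>\<^sub>h B"

inductive_cases middle_typingE [elim!]:
  "MId b : A \<Rightarrow>\<^sub>m B" "MOp op c d : A \<Rightarrow>\<^sub>m B"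

lemma begin_typing_src: "p : A \<Rightarrow>\<^sub>p B \<Longrightarrow> begin_src p = A"
  by (induction rule: begin_typing.induct) auto

lemma end_typing_tgt: "i : A \<Rightarrow>\<^sub>i B \<Longrightarrow> end_tgt i = B"
  by (induction rule: end_typing.induct) auto

lemma hc_typing_src: "c : A \<Rightarrow>\<^sub>h B \<Longrightarrow> hc_src c = A"
  by (cases c) (auto simp: begin_typing_src)

lemma hc_typing_tgt: "c : A \<Rightarrow>\<^sub>h B \<Longrightarrow> hc_tgt c = B"
  by (cases c) (auto simp: end_typing_tgt)

text \<open>This rules out \<open>EId\<close> before \<open>Prj\<close> and \<open>Inj\<close>
  before \<open>PId\<close>, two of the pairs for which \<open>compose\<close> has no
  equation.\<close>

lemma middle_typing_not_dyn:
  assumes "m : A \<Rightarrow>\<^sub>m B"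
  shows "A \<noteq> \<star>" "B \<noteq> \<star>"
  using assms by (cases m; auto)+

section \<open>Height of hypercoercions, size bound and composition\<close>

primrec hc_height :: "'l hcoercion \<Rightarrow> nat" and middle_height :: "'l hmiddle \<Rightarrow> nat" where
  "hc_height CId = 0"
| "hc_height (CSeq p m i) = middle_height m"
| "middle_height (MId b) = 0"
| "middle_height (MOp op c d) = Suc (max (hc_height c) (hc_height d))"

text \<open>The offsets make the induction close: \<open>CSeq\<close> adds at most 4 = 9 - 5, and
  for \<open>MOp\<close> the sum 1 + 9 splits into 5 + 5, one share for each component. Beginnings
  and ends have bounded size, so only nested \<open>MOp\<close> needs to count towards the
  height.\<close>

lemma size_le_height:
  fixes c :: "'l hcoercion" and m :: "'l hmiddle"
  shows "hc_size c + 5 \<le> 9 * 2 ^ hc_height c"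
    and "middle_size m + 9 \<le> 9 * 2 ^ middle_height m"
proof (induction c and m)
  case CId
  show ?case by simp
next
  case (CSeq p m i)
  have "begin_size p \<le> 1" "end_size i \<le> 1"
    by (cases p; simp) (cases i; simp)
  with CSeq show ?case by simp
next
  case (MId b)
  show ?case by simp
next
  case (MOp op c d)
  define h where "h = max (hc_height c) (hc_height d)"
  have "(2::nat) ^ hc_height c \<le> 2 ^ h" "(2::nat) ^ hc_height d \<le> 2 ^ h"
    unfolding h_def by (intro power_increasing; simp)+
  with MOp have "hc_size c + hc_size d + 10 \<le> 9 * 2 ^ Suc h"
    unfolding power_Suc by linarith
  then show ?case by (simp add: h_def)
qed

text \<open>Middles are merged level by level, so nothing gets nested deeper, and a failure drops
  the second middle. The height bound relies on typing, which excludes the pairs without an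
  equation.\<close>

lemma compose_typing_height:
  fixes c d :: "'l hcoercion" and m n :: "'l hmiddle"
  shows "c : A \<Rightarrow>\<^sub>h B \<Longrightarrow> d : B \<Rightarrow>\<^sub>h C \<Longrightarrow>
      (c \<^bold>* d : A \<Rightarrow>\<^sub>h C) \<and> hc_height (c \<^bold>* d) \<le> max (hc_height c) (hc_height d)"
    and "m : A \<Rightarrow>\<^sub>m B \<Longrightarrow> n : B \<Rightarrow>\<^sub>m C \<Longrightarrow>
      (m \<^bold>*\<^sub>m n : A \<Rightarrow>\<^sub>m C) \<and> middle_height (m \<^bold>*\<^sub>m n) \<le> max (middle_height m) (middle_height n)"
proof (induction c d and m n arbitrary: A B C and A B C rule: compose_compose_m.induct)
  case (7 op c1 d1 op' c2 d2)
  show ?case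
  proof (cases op)
    case Arr
    with "7.prems" obtain A1 A2 B1 B2 C1 C2 where
      "A = A1 \<rightarrow>\<^sub>t A2" "C = C1 \<rightarrow>\<^sub>t C2" "op' = Arr"
      "c1 : B1 \<Rightarrow>\<^sub>h A1" "d1 : A2 \<Rightarrow>\<^sub>h B2" "c2 : C1 \<Rightarrow>\<^sub>h B1" "d2 : B2 \<Rightarrow>\<^sub>h C2"
      by auto
    with Arr "7.IH"(1)[of C1 B1 A1] "7.IH"(3)[of A2 B2 C2] show ?thesis
      by (auto intro!: hc_typing_middle_typing.intros)
  next
    case Times
    with "7.prems" obtain A1 A2 B1 B2 C1 C2 where
      "A = A1 \<times>\<^sub>t A2" "C = C1 \<times>\<^sub>t C2" "op' = Times"
      "c1 : A1 \<Rightarrow>\<^sub>h B1" "d1 : A2 \<Rightarrow>\<^sub>h B2" "c2 : B1 \<Rightarrow>\<^sub>h C1" "d2 : B2 \<Rightarrow>\<^sub>h C2"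
      by auto
    with Times "7.IH"(2)[of A1 B1 C1] "7.IH"(3)[of A2 B2 C2] show ?thesis
      by (auto intro!: hc_typing_middle_typing.intros)
  next
    case Plus
    with "7.prems" obtain A1 A2 B1 B2 C1 C2 where
      "A = A1 +\<^sub>t A2" "C = C1 +\<^sub>t C2" "op' = Plus"
      "c1 : A1 \<Rightarrow>\<^sub>h B1" "d1 : A2 \<Rightarrow>\<^sub>h B2" "c2 : B1 \<Rightarrow>\<^sub>h C1" "d2 : B2 \<Rightarrow>\<^sub>h C2"
      by auto
    with Plus "7.IH"(2)[of A1 B1 C1] "7.IH"(3)[of A2 B2 C2] show ?thesis
      by (auto intro!: hc_typing_middle_typing.intros)
  qed
qed (fastforce intro: hc_typing_middle_typing.intros begin_typing.intros end_typing.intros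
       simp: end_typing_tgt dest: middle_typing_not_dyn split: if_splits)+

section \<open>Consistency and the cast constructor\<close>

lemma consistent_sym: "A \<sim> B \<Longrightarrow> B \<sim> A"
  by (induction rule: consistent.induct) (auto intro: consistent.intros)

lemma consistent_refl: "A \<sim> A"
  by (induction A) (auto intro: consistent.intros)

lemma consistent_join:
  assumes "A \<sim> B"
  shows "A \<sim> A \<squnion>\<^sub>t B" "B \<sim> A \<squnion>\<^sub>t B"
proof -
  have "A \<sim> A \<squnion>\<^sub>t B \<and> B \<sim> A \<squnion>\<^sub>t B"
    using assms
  proof (induction rule: consistent.induct)
    \<comment> \<open>\<open>join\<close> tests its second argument for \<open>\<star>\<close>
      first, so it unfolds only after a split on \<open>B\<close>.\<close>
    case (2 B)
    then show ?case by (cases B) (auto intro: consistent.intros consistent_refl)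
  qed (auto intro: consistent.intros consistent_refl)
  then show "A \<sim> A \<squnion>\<^sub>t B" "B \<sim> A \<squnion>\<^sub>t B" by auto
qed

inductive_cases consistentE [elim!]:
  "Base b \<sim> Base b'" "Base b \<sim> TOp op A B" "TOp op A B \<sim> Base b" "TOp op A B \<sim> TOp op' A' B'"

lemma gnd_consistent: "A \<noteq> \<star> \<Longrightarrow> A \<sim> gnd A"
  by (cases A) (auto intro: consistent.intros)

lemma ground_gnd: "A \<noteq> \<star> \<Longrightarrow> ground (gnd A)"
  by (cases A) (auto intro: ground.intros)

lemma gnd_not_dyn: "A \<noteq> \<star> \<Longrightarrow> gnd A \<noteq> \<star>"
  by (cases A) auto

lemma coerce_typing:
  fixes l :: 'l
  shows "A \<sim> B \<Longrightarrow> coerce A B l : A \<Rightarrow>\<^sub>h B"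
    and "A \<sim> B \<Longrightarrow> A \<noteq> \<star> \<Longrightarrow> B \<noteq> \<star> \<Longrightarrow> coerce_m A B l : A \<Rightarrow>\<^sub>m B"
proof (induction A B l and A B l rule: coerce_coerce_m.induct)
  case (6 op A B op' A' B' l)
  then show ?case
    by (cases op) (auto intro!: hc_typing_middle_typing.intros dest: consistent_sym)
qed (auto intro!: hc_typing_middle_typing.intros begin_typing.intros end_typing.intros
      ground_gnd gnd_consistent consistent_sym[OF gnd_consistent] gnd_not_dyn
    simp del: coerce_m.simps(2) gnd.simps)

section \<open>Subject reduction\<close>

inductive_cases htypingE [elim!]:
  "\<Gamma> \<turnstile>\<^sub>H HConst P k : A" "\<Gamma> \<turnstile>\<^sub>H HVar x : A" "\<Gamma> \<turnstile>\<^sub>H HLam B M : A" "\<Gamma> \<turnstile>\<^sub>H HApp L M : A"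
  "\<Gamma> \<turnstile>\<^sub>H HIf L M N : A" "\<Gamma> \<turnstile>\<^sub>H HCons M N : A" "\<Gamma> \<turnstile>\<^sub>H HFst M : A" "\<Gamma> \<turnstile>\<^sub>H HSnd M : A"
  "\<Gamma> \<turnstile>\<^sub>H HInl B M : A" "\<Gamma> \<turnstile>\<^sub>H HInr B M : A" "\<Gamma> \<turnstile>\<^sub>H HCase L M N : A" "\<Gamma> \<turnstile>\<^sub>H M\<langle>c\<rangle> : A"
  "\<Gamma> \<turnstile>\<^sub>H HBlame B l : A"

text \<open>Used for \<open>red_frame_blame\<close>, where the annotation of the resulting
  \<open>HBlame\<close> must agree with the given type.\<close>

lemma htyping_unique: "\<Gamma> \<turnstile>\<^sub>H M : A \<Longrightarrow> \<Gamma> \<turnstile>\<^sub>H M : B \<Longrightarrow> B = A"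
proof (induction arbitrary: B rule: htyping.induct)
  case (12 \<Gamma> M A c B)
  then show ?case by (metis htypingE(12) hc_typing_tgt)
qed blast+

lemma shift_typing:
  "\<Gamma>1 @ \<Gamma>2 \<turnstile>\<^sub>H M : A \<Longrightarrow> \<Gamma>1 @ B # \<Gamma>2 \<turnstile>\<^sub>H shift (length \<Gamma>1) M : A"
proof (induction M arbitrary: \<Gamma>1 A)
  case (HVar x)
  have "(\<Gamma>1 @ B # \<Gamma>2) ! (if x < length \<Gamma>1 then x else Suc x) = (\<Gamma>1 @ \<Gamma>2) ! x"
    by (simp add: nth_append Suc_diff_le)
  with HVar htyping.intros(2)[of "if x < length \<Gamma>1 then x else Suc x" "\<Gamma>1 @ B # \<Gamma>2"]
  show ?case by auto
next
  case (HLam A' M)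
  then show ?case using HLam.IH[of "A' # \<Gamma>1"] by (auto intro!: htyping.intros)
qed (fastforce intro: htyping.intros)+

lemma shift_0_typing: "\<Gamma> \<turnstile>\<^sub>H M : A \<Longrightarrow> B # \<Gamma> \<turnstile>\<^sub>H shift 0 M : A"
  using shift_typing[of "[]"] by simp

lemma subst_typing:
  "\<Gamma>1 @ B # \<Gamma>2 \<turnstile>\<^sub>H M : A \<Longrightarrow> \<Gamma>1 @ \<Gamma>2 \<turnstile>\<^sub>H V : B \<Longrightarrow> \<Gamma>1 @ \<Gamma>2 \<turnstile>\<^sub>H subst (length \<Gamma>1) V M : A"
proof (induction M arbitrary: \<Gamma>1 A V)
  case (HVar x)
  consider "x < length \<Gamma>1" | "x = length \<Gamma>1" | "x > length \<Gamma>1" by linarith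
  then show ?case
  proof cases
    case 1
    with HVar htyping.intros(2)[of x "\<Gamma>1 @ \<Gamma>2"] show ?thesis by (auto simp: nth_append)
  next
    case 2
    with HVar show ?thesis by auto
  next
    case 3
    then obtain y where "x = Suc y" "y \<ge> length \<Gamma>1" by (cases x) auto
    with HVar htyping.intros(2)[of y "\<Gamma>1 @ \<Gamma>2"] show ?thesis
      by (auto simp: nth_append Suc_diff_le)
  qed
next
  case (HLam A' M)
  from HLam.prems(2) have "A' # \<Gamma>1 @ \<Gamma>2 \<turnstile>\<^sub>H shift 0 V : B" by (rule shift_0_typing)
  with HLam.prems HLam.IH[of "A' # \<Gamma>1"] show ?case by (auto intro!: htyping.intros)
qed (fastforce intro: htyping.intros)+

lemma subst_0_typing: "B # \<Gamma> \<turnstile>\<^sub>H M : A \<Longrightarrow> \<Gamma> \<turnstile>\<^sub>H V : B \<Longrightarrow> \<Gamma> \<turnstile>\<^sub>H subst 0 V M : A"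
  using subst_typing[of "[]"] by simp

lemma ty_of_prim_not_dyn: "ty_of_prim P \<noteq> \<star>"
  by (cases P) auto

lemma simple_not_dyn:
  assumes "simple S" "\<Gamma> \<turnstile>\<^sub>H S : A"
  shows "A \<noteq> \<star>"
  using assms by (cases rule: simple.cases) (auto simp: ty_of_prim_not_dyn)

lemma ty_of_prim_eq_base: "ty_of_prim P = Base b \<longleftrightarrow> P = PBase b"
  by (cases P) auto

lemma ty_of_prim_eq_TOp:
  "ty_of_prim P = TOp op A B \<longleftrightarrow> op = Arr \<and> (\<exists>b Q. P = PFun b Q \<and> A = Base b \<and> B = ty_of_prim Q)"
  by (cases P) auto

lemma frame_typing:
  assumes "frame F" "\<Gamma> \<turnstile>\<^sub>H F M : A"
  shows "\<exists>B. \<Gamma> \<turnstile>\<^sub>H M : B \<and> (\<forall>M'. \<Gamma> \<turnstile>\<^sub>H M' : B \<longrightarrow> \<Gamma> \<turnstile>\<^sub>H F M' : A)"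
  using assms by (cases rule: frame.cases) (fastforce intro: htyping.intros)+

lemma apply_cast_id [simp]: "apply_cast S (CSeq (PId A) (MId b) (EId B)) = S"
  by (cases S) auto

text \<open>As simple values never have type \<open>\<star>\<close>, no identity on
  \<open>\<star>\<close> and no projection can occur; in the product and sum cases the source type
  determines the shape of the value. The effect of \<open>apply_cast\<close> on types, heights and
  spacing is read off these cases.\<close>

lemma active_cast_cases [consumes 3, case_names fail times inl inr base]:
  assumes "simple S" "active c" "\<Gamma> \<turnstile>\<^sub>H S\<langle>c\<rangle> : T"
  obtains A m B l where "c = CSeq (PId A) m (Fail B T l)"
    | V W d e A where "S = HCons V W" "c = cross Times d e A T"
    | B V d e A where "S = HInl B V" "c = cross Plus d e A T"
    | B V d e A where "S = HInr B V" "c = cross Plus d e A T"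
    | A b where "c = CSeq (PId A) (MId b) (EId T)"
proof -
  from assms(3) obtain A where S: "\<Gamma> \<turnstile>\<^sub>H S : A" and c: "c : A \<Rightarrow>\<^sub>h T" by auto
  note dyn = simple_not_dyn[OF assms(1) S]
  from assms(2) show thesis
  proof cases
    case (3 p m A' B' l)
    with c dyn show ?thesis by (cases p) (auto intro: that(1))
  next
    case (4 d e A' B')
    with assms(1) S c show ?thesis
      by (cases rule: simple.cases) (auto intro: that(2) simp: ty_of_prim_eq_TOp)
  next
    case (5 d e A' B')
    with assms(1) S c show ?thesis
      by (cases rule: simple.cases) (auto intro: that(3,4) simp: ty_of_prim_eq_TOp)
  qed (use c dyn in \<open>auto intro: that(5)\<close>)
qed

lemma apply_cast_typing:
  assumes "simple S" "active c" "\<Gamma> \<turnstile>\<^sub>H S\<langle>c\<rangle> : T"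
  shows "\<Gamma> \<turnstile>\<^sub>H apply_cast S c : T"
  using assms
  by (cases rule: active_cast_cases)
    (use assms(3) in \<open>auto intro!: htyping.intros simp: hc_typing_tgt\<close>)

lemma red_typing:
  assumes "red \<Gamma> ctx M M'" "\<Gamma> \<turnstile>\<^sub>H M : A"
  shows "\<Gamma> \<turnstile>\<^sub>H M' : A"
  using assms
proof (induction arbitrary: A rule: red.induct)
  case (red_frame F ctx M M')
  then show ?case by (meson frame_typing)
next
  case (red_frame_blame F A' l B)
  then show ?case by (metis htyping_unique htyping.intros(13))
next
  case (red_apply_cast S c)
  then show ?case by (intro apply_cast_typing)
next
  case (red_compose M c d)
  then obtain B C where "\<Gamma> \<turnstile>\<^sub>H M : B" "c : B \<Rightarrow>\<^sub>h C" "d : C \<Rightarrow>\<^sub>h A" by auto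
  then show ?case using compose_typing_height(1)[of c B C d A] by (auto intro: htyping.intros)
next
  case (red_case_cast V c d A' B' M N)
  have var: "X # \<Gamma> \<turnstile>\<^sub>H HVar 0 : X" for X
    using htyping.intros(2)[of 0 "X # \<Gamma>"] by simp
  from red_case_cast show ?case
    by (auto simp: hc_typing_src intro!: htyping.intros var intro: shift_0_typing)
next
  case (red_delta b P f r)
  then show ?case
    by (auto simp: ty_of_prim_eq_base ty_of_prim_eq_TOp intro!: htyping.intros)
qed (fastforce intro: htyping.intros subst_0_typing simp: hc_typing_tgt)+

section \<open>Typing of compiled terms\<close>

lemma matches_consistent: "matches A op A1 A2 \<Longrightarrow> A \<sim> TOp op A1 A2"
  by (auto simp: matches_def intro: consistent.intros consistent_refl)

lemma compile_typing: "\<Gamma> \<turnstile>\<^sub>G M : A \<Longrightarrow> \<Gamma> \<turnstile>\<^sub>H compile \<Gamma> M : A"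
proof (induction rule: gtyping.induct)
  \<comment> \<open>Application is treated apart because its rule provides
    \<open>A1 \<sim> B\<close>, whereas the argument is cast from \<open>B\<close> to
    \<open>A1\<close>.\<close>
  case (gt_app \<Gamma> L A M B A1 A2 l)
  then have "A \<sim> A1 \<rightarrow>\<^sub>t A2" "B \<sim> A1" "match1 A = A1" "match2 A = A2"
    by (auto simp: matches_consistent consistent_sym matches_parts)
  with gt_app show ?case
    by (auto simp: gtype_of_eq Let_def intro!: htyping.intros coerce_typing(1))
qed (auto simp: gtype_of_eq Let_def dest: matches_parts
      intro!: htyping.intros coerce_typing(1) matches_consistent consistent_join)

section \<open>Heights of casts\<close>

text \<open>A maximum rather than a sum, since substitution may duplicate casts.\<close>

primrec cast_height :: "'l hterm \<Rightarrow> nat" where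
  "cast_height (HConst P k) = 0"
| "cast_height (HVar x) = 0"
| "cast_height (HLam A M) = cast_height M"
| "cast_height (HApp L M) = max (cast_height L) (cast_height M)"
| "cast_height (HIf L M N) = max (cast_height L) (max (cast_height M) (cast_height N))"
| "cast_height (HCons M N) = max (cast_height M) (cast_height N)"
| "cast_height (HFst M) = cast_height M"
| "cast_height (HSnd M) = cast_height M"
| "cast_height (HInl B M) = cast_height M"
| "cast_height (HInr A M) = cast_height M"
| "cast_height (HCase L M N) = max (cast_height L) (max (cast_height M) (cast_height N))"
| "cast_height (M\<langle>c\<rangle>) = max (cast_height M) (hc_height c)"
| "cast_height (HBlame A l) = 0"

lemma cast_height_shift [simp]: "cast_height (shift k M) = cast_height M"
  by (induction M arbitrary: k) auto

lemma cast_height_subst: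
  "cast_height V \<le> h \<Longrightarrow> cast_height M \<le> h \<Longrightarrow> cast_height (subst k V M) \<le> h"
  by (induction M arbitrary: k V) auto

lemma cast_height_frame:
  "frame F \<Longrightarrow> cast_height M' \<le> cast_height M \<Longrightarrow> cast_height (F M') \<le> cast_height (F M)"
  by (cases rule: frame.cases) auto

lemma cast_height_apply_cast:
  assumes "simple S" "active c" "\<Gamma> \<turnstile>\<^sub>H S\<langle>c\<rangle> : T"
  shows "cast_height (apply_cast S c) \<le> cast_height (S\<langle>c\<rangle>)"
  using assms by (cases rule: active_cast_cases) auto

lemma cast_height_red:
  assumes "red \<Gamma> ctx M M'" "\<Gamma> \<turnstile>\<^sub>H M : A"
  shows "cast_height M' \<le> cast_height M"
  using assms
proof (induction arbitrary: A rule: red.induct)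
  case (red_frame F ctx M M')
  then show ?case by (meson frame_typing cast_height_frame)
next
  case (red_apply_cast S c)
  then show ?case by (intro cast_height_apply_cast)
next
  case (red_compose M c d)
  then obtain B C where "c : B \<Rightarrow>\<^sub>h C" "d : C \<Rightarrow>\<^sub>h A" by auto
  then show ?case using compose_typing_height(1)[of c B C d A] by auto
next
  case (red_beta V A' M)
  then show ?case by (auto intro: cast_height_subst)
qed fastforce+

section \<open>Adjacent casts\<close>

text \<open>Variables count as casts, because the value that replaces a variable may be a cast.\<close>

primrec adjacent :: "'l hterm \<Rightarrow> nat" where
  "adjacent (HConst P k) = 0"
| "adjacent (HVar x) = 1"
| "adjacent (HLam A M) = 0"
| "adjacent (HApp L M) = 0"
| "adjacent (HIf L M N) = 0"
| "adjacent (HCons M N) = 0"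
| "adjacent (HFst M) = 0"
| "adjacent (HSnd M) = 0"
| "adjacent (HInl B M) = 0"
| "adjacent (HInr A M) = 0"
| "adjacent (HCase L M N) = 0"
| "adjacent (M\<langle>c\<rangle>) = Suc (adjacent M)"
| "adjacent (HBlame A l) = 0"

text \<open>The bound \<open>n\<close> applies to the evaluated positions only. Everywhere else, the bound is \<open>2\<close>:
  such a position can become the body of an evaluated cast, which has room for one more cast.\<close>

primrec spaced :: "nat \<Rightarrow> 'l hterm \<Rightarrow> bool" where
  "spaced n (HConst P k) \<longleftrightarrow> True"
| "spaced n (HVar x) \<longleftrightarrow> True"
| "spaced n (HLam A M) \<longleftrightarrow> spaced 2 M"
| "spaced n (HApp L M) \<longleftrightarrow> spaced n L \<and> spaced n M"
| "spaced n (HIf L M N) \<longleftrightarrow> spaced n L \<and> spaced 2 M \<and> spaced 2 N"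
| "spaced n (HCons M N) \<longleftrightarrow> spaced n M \<and> spaced n N"
| "spaced n (HFst M) \<longleftrightarrow> spaced n M"
| "spaced n (HSnd M) \<longleftrightarrow> spaced n M"
| "spaced n (HInl B M) \<longleftrightarrow> spaced n M"
| "spaced n (HInr A M) \<longleftrightarrow> spaced n M"
| "spaced n (HCase L M N) \<longleftrightarrow> spaced n L \<and> spaced 2 M \<and> spaced 2 N"
| "spaced n (M\<langle>c\<rangle>) \<longleftrightarrow> spaced n M \<and> adjacent M < n"
| "spaced n (HBlame A l) \<longleftrightarrow> True"

lemma spaced_mono: "spaced n M \<Longrightarrow> n \<le> n' \<Longrightarrow> spaced n' M"
  by (induction M) auto

text \<open>Positivity of \<open>n\<close> is for variables, which are spaced for every
  \<open>n\<close> but count as one cast.\<close>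

lemma adjacent_le: "spaced n M \<Longrightarrow> 0 < n \<Longrightarrow> adjacent M \<le> n"
  by (cases M) auto

lemma adjacent_shift [simp]: "adjacent (shift k M) = adjacent M"
  by (induction M) auto

lemma spaced_shift [simp]: "spaced n (shift k M) = spaced n M"
  by (induction M arbitrary: n k) auto

lemma adjacent_subst: "adjacent V \<le> 1 \<Longrightarrow> adjacent (subst k V M) \<le> adjacent M"
  by (induction M) auto

lemma spaced_subst:
  "spaced 2 V \<Longrightarrow> adjacent V \<le> 1 \<Longrightarrow> spaced 2 M \<Longrightarrow> spaced 2 (subst k V M)"
  by (induction M arbitrary: k V) (auto intro: le_less_trans[OF adjacent_subst])

lemma simple_adjacent: "simple S \<Longrightarrow> adjacent S = 0"
  by (cases rule: simple.cases) auto

lemma val_adjacent: "val V \<Longrightarrow> adjacent V \<le> 1"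
  by (cases rule: val.cases) (auto simp: simple_adjacent)

text \<open>In a value, each cast outside lambda bodies wraps a simple value, and lambda bodies obey
  the bound 2 by definition. This allows beta reduction to move an argument from an evaluated
  position into a body.\<close>

lemma val_spaced:
  fixes S V :: "'l hterm"
  shows "simple S \<Longrightarrow> spaced n S \<Longrightarrow> spaced 2 S"
    and "val V \<Longrightarrow> spaced n V \<Longrightarrow> spaced 2 V"
  by (induction S and V rule: simple_val.inducts) (auto simp: simple_adjacent)

lemma frame_spaced: "frame F \<Longrightarrow> spaced n (F M) \<Longrightarrow> spaced n M"
  by (cases rule: frame.cases) auto

lemma spaced_frame: "frame F \<Longrightarrow> spaced n (F M) \<Longrightarrow> spaced n M' \<Longrightarrow> spaced n (F M')"
  by (cases rule: frame.cases) auto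

lemma adjacent_frame: "frame F \<Longrightarrow> adjacent (F M) = 0"
  by (cases rule: frame.cases) auto

text \<open>The cast moves onto components that are values, so at most two casts are adjacent
  there.\<close>

lemma spaced_apply_cast:
  assumes "simple S" "active c" "\<Gamma> \<turnstile>\<^sub>H S\<langle>c\<rangle> : T" "spaced 3 S"
  shows "spaced 3 (apply_cast S c)"
  using assms(1-3)
  by (cases rule: active_cast_cases)
    (use assms(1,4) in \<open>auto elim!: simple.cases dest!: val_adjacent\<close>)

text \<open>No rule for \<open>Any\<close> applies to a cast, so that \<open>red_cast\<close> reduces below a single cast only.
  This is why adjacent casts do not accumulate.\<close>

lemma spaced_red:
  assumes "red \<Gamma> ctx M M'" "\<Gamma> \<turnstile>\<^sub>H M : A" "spaced 3 M"
  shows "spaced 3 M' \<and> (ctx = Any \<longrightarrow> adjacent M' \<le> 2)"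
  using assms
proof (induction arbitrary: A rule: red.induct)
  case (red_frame F ctx M M')
  then show ?case by (metis frame_typing frame_spaced spaced_frame adjacent_frame zero_le)
next
  \<comment> \<open>The premise is a step in \<open>Any\<close>, so at most two casts surround the
    reduct before \<open>c\<close> is added.\<close>
  case (red_cast M M' c)
  then show ?case by fastforce
next
  case (red_apply_cast S c)
  then show ?case using spaced_apply_cast[of S c \<Gamma> A] by simp
next
  case (red_beta V A' M)
  then have "spaced 2 (subst 0 V M)"
    by (auto intro: spaced_subst val_adjacent val_spaced(2))
  then show ?case by (auto intro: spaced_mono dest: adjacent_le)
\<comment> \<open>A chosen branch of \<open>HIf\<close> obeys the bound 2 already. In
  \<open>red_fun_cast\<close> the argument is a value and has at most one cast before
  \<open>c\<close> is added.\<close>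
qed (auto dest: val_adjacent spaced_mono[of 2 _ 3] adjacent_le[of 2])

text \<open>No compiled term is itself a cast, and only a variable has count one, so a cast put
  around it stays within the bound 2.\<close>

lemma spaced_compile: "spaced 2 (compile \<Gamma> M) \<and> adjacent (compile \<Gamma> M) \<le> 1"
  by (induction M arbitrary: \<Gamma>) (auto simp: Let_def less_Suc_eq_le numeral_2_eq_2)

section \<open>Space consumption\<close>

lemma steps_invariant:
  assumes "\<Gamma> \<turnstile> M \<longrightarrow>\<^sub>H\<^sup>* M'" "\<Gamma> \<turnstile>\<^sub>H M : A" "spaced 3 M"
  shows "\<Gamma> \<turnstile>\<^sub>H M' : A \<and> spaced 3 M' \<and> cast_height M' \<le> cast_height M"
  using assms(1)
proof (induction rule: rtranclp_induct)
  case base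
  then show ?case using assms by simp
next
  case (step M' M'')
  then show ?case
    unfolding step_def by (meson red_typing spaced_red cast_height_red order_trans)
qed

text \<open>The term \<open>3 * K\<close> on the left pays for the casts that may still be put around \<open>M\<close>.\<close>

lemma real_size_adjacent:
  fixes h :: nat
  defines "K \<equiv> 9 * 2 ^ h"
  assumes "spaced 3 M" "cast_height M \<le> h"
  shows "real_size M \<le> (1 + 3 * K) * ideal_size M \<and>
    real_size M + 3 * K \<le> (1 + 3 * K) * ideal_size M + adjacent M * K"
proof -
  define L where "L = 1 + 3 * K"
  have "real_size M \<le> L * ideal_size M \<and>
      real_size M + 3 * K \<le> L * ideal_size M + adjacent M * K"
    using assms(2,3)
  proof (induction M)
    case (HCast M c)
    have "(2::nat) ^ hc_height c \<le> 2 ^ h"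
      using HCast.prems by (intro power_increasing) auto
    with size_le_height(1)[of c] have "hc_size c \<le> K"
      unfolding K_def by linarith
    \<comment> \<open>The cast costs at most \<open>K\<close>, which the increase of
      \<open>adjacent\<close> by one pays for.\<close>
    with HCast have "real_size (M\<langle>c\<rangle>) + 3 * K
        \<le> L * ideal_size (M\<langle>c\<rangle>) + adjacent (M\<langle>c\<rangle>) * K"
      by simp
    \<comment> \<open>With at most three adjacent casts, the first inequality follows from the
      second.\<close>
    moreover have "adjacent (M\<langle>c\<rangle>) * K \<le> 3 * K"
      using HCast.prems by (intro mult_right_mono) auto
    ultimately show ?case by linarith
  \<comment> \<open>Every other constructor adds one to the ideal size and hence \<open>L\<close>: 1
    for itself and \<open>3 * K\<close> as a new reserve.\<close>
  qed (use L_def in \<open>auto simp: add_mult_distrib2 dest!: spaced_mono[of 2 _ 3]\<close>)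
  then show ?thesis unfolding L_def .
qed

theorem corollary149:
  fixes M :: "'l gterm" and \<Gamma> :: ctxt and A :: ty
  assumes "\<Gamma> \<turnstile>\<^sub>G M : A"
  shows "\<exists>c::nat. \<forall>M' :: 'l hterm. \<Gamma> \<turnstile>\<^sub>H M' : A \<longrightarrow> \<Gamma> \<turnstile> compile \<Gamma> M \<longrightarrow>\<^sub>H\<^sup>* M' \<longrightarrow>
           real_size M' \<le> c * ideal_size M'"
proof (intro exI allI impI)
  fix M' :: "'l hterm"
  assume "\<Gamma> \<turnstile> compile \<Gamma> M \<longrightarrow>\<^sub>H\<^sup>* M'"
  moreover have "\<Gamma> \<turnstile>\<^sub>H compile \<Gamma> M : A" using assms by (rule compile_typing)
  moreover have "spaced 3 (compile \<Gamma> M)"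
    by (rule spaced_mono[of 2]) (simp_all add: spaced_compile)
  ultimately have "spaced 3 M'" "cast_height M' \<le> cast_height (compile \<Gamma> M)"
    using steps_invariant by blast+
  \<comment> \<open>The constant depends only on the height of the casts in the compiled term, not
    on the reduct.\<close>
  then show "real_size M' \<le> (1 + 3 * (9 * 2 ^ cast_height (compile \<Gamma> M))) * ideal_size M'"
    using real_size_adjacent by blast
qed

end
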